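(* Fix $k,n\geq 1$. If $r_1,r_2,r_3$ are positive integers with $$r_1<r_2<\overline{R}_{\mathsf{S}}<r_3\le R_{\mathsf{S}},$$ then $$\overline{\mathcal{Z}}_{r_1}\subsetneq\overline{\mathcal{Z}}_{r_2}\subsetneq\overline{\mathcal{Z}}_{\overline{R}_{\mathsf{S}}}\supsetneq\overline{\mathcal{Z}}_{r_3}.$$
   Context: $\mathsf{S}^k(\mathbb{C}^n)$ is the space of symmetric order-$k$ tensors, i.e. elements of $(\mathbb{C}^n)^{\otimes k}$ invariant under all permutations of the $k$ factors. For $A\in\mathsf{S}^k(\mathbb{C}^n)$, the symmetric rank $\operatorname{rank}_{\mathsf{S}}(A)$ is the least $s\ge0$ such that $A=\sum_{i=1}^s\mathbf{y}_i^{\otimes k}$ with $\mathbf{y}_i\in\mathbb{C}^n$. Put $\mathcal{Y}_r=\{A\in\mathsf{S}^k(\mathbb{C}^n)\mid\operatorname{rank}_{\mathsf{S}}(A)\le r\}$ and $\mathcal{Z}_r=\{A\in\mathsf{S}^k(\mathbb{C}^n)\mid\operatorname{rank}_{\mathsf{S}}(A)=r\}$; an overline on a set denotes its Zariski closure in $\mathsf{S}^k(\mathbb{C}^n)$. The generic symmetric rank and the maximal symmetric rank are $$\overline{R}_{\mathsf{S}}=\overline{R}_{\mathsf{S}}(k,n)=\min\{r\mid\overline{\mathcal{Y}}_r=\mathsf{S}^k(\mathbb{C}^n)\},\qquad R_{\mathsf{S}}=R_{\mathsf{S}}(k,n)=\min\{r\mid\mathcal{Y}_r=\mathsf{S}^k(\mathbb{C}^n)\}.$$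 *)

theory Defs
  imports "HOL-Analysis.Analysis"
begin

text \<open>
  An order-\<open>k\<close> tensor over \<open>\<complex>\<^sup>n\<close> is the hypermatrix of its coordinates in the standard basis:
  an index type \<open>'k\<close> with \<open>k\<close> elements for the factors and \<open>'n\<close> with \<open>n\<close> elements for the
  coordinates of \<open>\<complex>\<^sup>n\<close>, and a multi-index is a function \<open>'k \<Rightarrow> 'n\<close>. Types are nonempty, so
  \<open>k, n \<ge> 1\<close>.
\<close>

type_synonym ('k, 'n) tensor = "complex ^ ('k \<Rightarrow> 'n)"

definition tensor_power :: "complex ^ 'n \<Rightarrow> ('k::finite, 'n::finite) tensor" where
  "tensor_power y = (\<chi> i. \<Prod>j\<in>UNIV. y $ i j)"

definition sym_tensors :: "('k::finite, 'n::finite) tensor set" where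
  "sym_tensors = {A. \<forall>\<pi>. bij \<pi> \<longrightarrow> (\<forall>i. A $ (i \<circ> \<pi>) = A $ i)}"

text \<open>
  Over \<open>\<complex>\<close> every symmetric tensor is a finite sum of \<open>k\<close>-th powers of vectors, so on
  \<^const>\<open>sym_tensors\<close> the \<open>LEAST\<close> below ranges over a nonempty set.
\<close>

definition sym_rank :: "('k::finite, 'n::finite) tensor \<Rightarrow> nat" where
  "sym_rank A = (LEAST s. \<exists>y :: nat \<Rightarrow> complex ^ 'n. A = (\<Sum>i<s. tensor_power (y i)))"

definition sym_rank_le :: "nat \<Rightarrow> ('k::finite, 'n::finite) tensor set" where
  "sym_rank_le r = {A \<in> sym_tensors. sym_rank A \<le> r}"

definition sym_rank_eq :: "nat \<Rightarrow> ('k::finite, 'n::finite) tensor set" where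
  "sym_rank_eq r = {A \<in> sym_tensors. sym_rank A = r}"

inductive polynomial_fun :: "(complex ^ 'i::finite \<Rightarrow> complex) \<Rightarrow> bool" where
  const: "polynomial_fun (\<lambda>x. c)"
| coord: "polynomial_fun (\<lambda>x. x $ i)"
| add: "polynomial_fun p \<Longrightarrow> polynomial_fun q \<Longrightarrow> polynomial_fun (\<lambda>x. p x + q x)"
| mult: "polynomial_fun p \<Longrightarrow> polynomial_fun q \<Longrightarrow> polynomial_fun (\<lambda>x. p x * q x)"

definition zero_locus :: "(complex ^ 'i::finite) set \<Rightarrow> (complex ^ 'i \<Rightarrow> complex) set \<Rightarrow> (complex ^ 'i) set" where
  "zero_locus V P = {x \<in> V. \<forall>p\<in>P. p x = 0}"

text \<open>
  For a linear subspace \<open>V\<close> every polynomial function on \<open>V\<close> is the restriction of one on the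
  ambient space, so the topology below is the Zariski topology of \<open>V\<close> as an affine space.
\<close>

definition zariski :: "(complex ^ 'i::finite) set \<Rightarrow> (complex ^ 'i) topology" where
  "zariski V = topology (\<lambda>U. U \<subseteq> V \<and> (\<exists>P \<subseteq> Collect polynomial_fun. V - U = zero_locus V P))"

lemma istopology_zariski:
  "istopology (\<lambda>U. U \<subseteq> V \<and> (\<exists>P \<subseteq> Collect polynomial_fun. V - U = zero_locus V P))"
  (is "istopology ?T")
  unfolding istopology_def
proof (intro conjI allI impI)
  fix S T assume "?T S" "?T T"
  then obtain P Q where P: "S \<subseteq> V" "P \<subseteq> Collect polynomial_fun" "V - S = zero_locus V P"
    and Q: "T \<subseteq> V" "Q \<subseteq> Collect polynomial_fun" "V - T = zero_locus V Q" by blast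
  let ?R = "{\<lambda>x. p x * q x | p q. p \<in> P \<and> q \<in> Q}"
  have "?R \<subseteq> Collect polynomial_fun"
    using P(2) Q(2) by (auto intro!: polynomial_fun.mult)
  moreover have "zero_locus V ?R = zero_locus V P \<union> zero_locus V Q"
    unfolding zero_locus_def by auto (metis mult_eq_0_iff)
  then have "V - (S \<inter> T) = zero_locus V ?R"
    using P(3) Q(3) by blast
  ultimately show "S \<inter> T \<subseteq> V"
    and "\<exists>P \<subseteq> Collect polynomial_fun. V - S \<inter> T = zero_locus V P"
    using P(1) by blast+
next
  fix K assume K: "\<forall>S\<in>K. ?T S"
  then show "\<Union>K \<subseteq> V" by blast
  obtain P where P: "\<And>S. S \<in> K \<Longrightarrow> P S \<subseteq> Collect polynomial_fun \<and> V - S = zero_locus V (P S)"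
    using K by metis
  have "V - \<Union>K = zero_locus V (\<Union>S\<in>K. P S)"
    using P unfolding zero_locus_def by fast
  moreover have "(\<Union>S\<in>K. P S) \<subseteq> Collect polynomial_fun"
    using P by blast
  ultimately show "\<exists>P \<subseteq> Collect polynomial_fun. V - \<Union>K = zero_locus V P"
    by blast
qed

lemma openin_zariski:
  "openin (zariski V) U \<longleftrightarrow> U \<subseteq> V \<and> (\<exists>P \<subseteq> Collect polynomial_fun. V - U = zero_locus V P)"
  unfolding zariski_def by (simp add: topology_inverse' istopology_zariski)

lemma topspace_zariski [simp]: "topspace (zariski V) = V"
proof -
  have "V - V = zero_locus V {\<lambda>x. 1}"
    by (simp add: zero_locus_def)
  then have "openin (zariski V) V"
    unfolding openin_zariski using polynomial_fun.const[of 1] by blast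
  then show ?thesis
    by (meson openin_subset openin_topspace openin_zariski subset_antisym)
qed

lemma closedin_zariski:
  "closedin (zariski V) C \<longleftrightarrow> (\<exists>P \<subseteq> Collect polynomial_fun. C = zero_locus V P)"
proof -
  have "zero_locus V P \<subseteq> V" for P
    by (auto simp: zero_locus_def)
  then show ?thesis
    unfolding closedin_def openin_zariski topspace_zariski
    by (metis Diff_subset double_diff order_refl)
qed

definition generic_sym_rank :: "'k::finite itself \<Rightarrow> 'n::finite itself \<Rightarrow> nat" where
  "generic_sym_rank _ _ =
    (LEAST r. zariski sym_tensors closure_of (sym_rank_le r :: ('k, 'n) tensor set) = sym_tensors)"

definition max_sym_rank :: "'k::finite itself \<Rightarrow> 'n::finite itself \<Rightarrow> nat" where
  "max_sym_rank _ _ = (LEAST r. (sym_rank_le r :: ('k, 'n) tensor set) = sym_tensors)"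

end

theory Submission
  imports Defs "HOL-Computational_Algebra.Fundamental_Theorem_Algebra"
begin

text \<open>
  Let \<open>Y\<^sub>r\<close> be the set of sums of at most \<open>r\<close> powers of vectors, let \<open>V\<close> be the space of symmetric
  tensors, and let \<open>g\<close> be the generic rank. By polarization every symmetric tensor is a sum of
  boundedly many powers (\<open>sym_tensors_eq_power_sums\<close>), so \<open>Y\<^sub>r\<close> is the set of tensors of rank at
  most \<open>r\<close>, it is all of \<open>V\<close> for some \<open>r\<close>, and \<open>g\<close> is attained.

  Two facts about \<open>Y\<^sub>r\<close> settle everything up to the generic rank. First, the closures of the \<open>Y\<^sub>r\<close>
  increase strictly until they reach \<open>V\<close>: if two consecutive ones agreed, adding a further power
  could never enlarge the closure again (\<open>power_sums_separated\<close>). Second, \<open>Y\<^sub>r\<close> is irreducible,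
  because any two of its points lie on a polynomial curve inside \<open>Y\<^sub>r\<close> (\<open>irreducible_power_sums\<close>).
  Hence for \<open>0 < r \<le> g\<close> the tensors of rank exactly \<open>r\<close>, that is \<open>Y\<^sub>r\<close> without \<open>Y\<^sub>r\<^sub>-\<^sub>1\<close>, are dense in
  the closure of \<open>Y\<^sub>r\<close> (\<open>closure_sym_rank_eq\<close>), and the strict chain for \<open>Y\<^sub>r\<close> carries over.

  Above the generic rank it must be excluded that the tensors outside the dense set \<open>Y\<^sub>g\<close> are dense
  as well. This is where Chevalley's theorem enters: as a projection of an algebraic set, \<open>Y\<^sub>g\<close> is
  constructible, and a dense constructible subset of the irreducible \<open>V\<close> contains a nonempty open
  set (\<open>constructible_power_sums\<close>, \<open>constructible_generically_decided\<close>). The projection theorem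
  (\<open>constructible_projection\<close>) is proved by classical elimination of one variable at a time:
  pseudo-division reduces a system of equations in that variable to a single one, and the
  univariate Nullstellensatz turns the remaining question whether \<open>P\<close> has a root outside those of
  \<open>Q\<close> into a divisibility.
\<close>

section \<open>Polynomial functions\<close>

lemma polynomial_fun_diff:
  assumes "polynomial_fun p" "polynomial_fun q"
  shows "polynomial_fun (\<lambda>x. p x - q x)"
  using polynomial_fun.add[OF assms(1) polynomial_fun.mult[OF polynomial_fun.const[of "-1"] assms(2)]]
  by simp

lemma polynomial_fun_sum:
  assumes "\<And>i. i \<in> I \<Longrightarrow> polynomial_fun (f i)"
  shows "polynomial_fun (\<lambda>x. \<Sum>i\<in>I. f i x)"
  using assms
  by (induction I rule: infinite_finite_induct) (auto intro: polynomial_fun.intros)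

lemma polynomial_fun_prod:
  assumes "\<And>i. i \<in> I \<Longrightarrow> polynomial_fun (f i)"
  shows "polynomial_fun (\<lambda>x. \<Prod>i\<in>I. f i x)"
  using assms
  by (induction I rule: infinite_finite_induct) (auto intro: polynomial_fun.intros)

lemma polynomial_fun_compose:
  assumes "polynomial_fun p" "\<And>i. polynomial_fun (\<lambda>x. f x $ i)"
  shows "polynomial_fun (\<lambda>x. p (f x))"
  using assms by (induction rule: polynomial_fun.induct) (auto intro: polynomial_fun.intros)

lemma polynomial_fun_curve:
  fixes \<gamma> :: "complex \<Rightarrow> complex ^ 'i::finite"
  assumes "polynomial_fun p" and \<gamma>: "\<And>i. \<exists>c. \<forall>t. \<gamma> t $ i = poly c t"
  shows "\<exists>c. \<forall>t. p (\<gamma> t) = poly c t"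
  using assms(1)
proof (induction rule: polynomial_fun.induct)
  case (const c)
  then show ?case by (intro exI[of _ "[:c:]"]) simp
next
  case (coord i)
  then show ?case by (rule \<gamma>)
next
  case (add p q)
  then show ?case by (metis poly_add)
next
  case (mult p q)
  then show ?case by (metis poly_mult)
qed

section \<open>Constructible sets\<close>

text \<open>
  A disjunctive normal form instead of a Boolean algebra: since existential quantification
  commutes with unions, a projection only has to be computed for a single system of equations and
  one inequation. The price is that closure under intersection has to be proved.
\<close>

inductive constructible :: "(complex ^ 'i::finite) set \<Rightarrow> bool" where
  basic: "finite P \<Longrightarrow> P \<subseteq> Collect polynomial_fun \<Longrightarrow> polynomial_fun q
    \<Longrightarrow> constructible {x. (\<forall>p\<in>P. p x = 0) \<and> q x \<noteq> 0}"
| Un: "constructible S \<Longrightarrow> constructible T \<Longrightarrow> constructible (S \<union> T)"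

lemma constructible_zero:
  assumes "polynomial_fun p"
  shows "constructible {x. p x = 0}"
  using constructible.basic[of "{p}" "\<lambda>_. 1"] assms by (simp add: polynomial_fun.const)

lemma constructible_nonzero:
  assumes "polynomial_fun p"
  shows "constructible {x. p x \<noteq> 0}"
  using constructible.basic[of "{}" p] assms by simp

lemma constructible_empty: "constructible {}"
  using constructible_nonzero[OF polynomial_fun.const[of 0]] by simp

lemma constructible_Int:
  assumes "constructible S" "constructible T"
  shows "constructible (S \<inter> T)"
  using assms
proof (induction S rule: constructible.induct)
  case (basic P q)
  from \<open>constructible T\<close> show ?case
  proof (induction T rule: constructible.induct)
    case (basic P' q')
    have "{x. (\<forall>p\<in>P. p x = 0) \<and> q x \<noteq> 0} \<inter> {x. (\<forall>p\<in>P'. p x = 0) \<and> q' x \<noteq> 0}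
      = {x. (\<forall>p\<in>P \<union> P'. p x = 0) \<and> q x * q' x \<noteq> 0}" by auto
    moreover have "constructible \<dots>"
      using basic \<open>finite P\<close> \<open>P \<subseteq> _\<close> \<open>polynomial_fun q\<close>
      by (intro constructible.basic polynomial_fun.mult) auto
    ultimately show ?case by simp
  next
    case (Un S T)
    then show ?case by (simp add: Int_Un_distrib constructible.Un)
  qed
next
  case (Un S S')
  then show ?case by (simp add: Int_Un_distrib2 constructible.Un)
qed

lemma constructible_some_nonzero:
  fixes d :: nat
  assumes "\<And>i. polynomial_fun (p i)"
  shows "constructible {x. \<exists>i<d. p i x \<noteq> 0}"
proof (induction d)
  case 0
  then show ?case by (simp add: constructible_empty)
next
  case (Suc d)
  have "{x. \<exists>i<Suc d. p i x \<noteq> 0} = {x. \<exists>i<d. p i x \<noteq> 0} \<union> {x. p d x \<noteq> 0}"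
    by (auto simp: less_Suc_eq)
  with Suc show ?case
    by (simp add: assms constructible.Un constructible_nonzero)
qed

lemma constructible_preimage:
  assumes "constructible S" and f: "\<And>i. polynomial_fun (\<lambda>x. f x $ i)"
  shows "constructible (f -` S)"
  using assms(1)
proof (induction rule: constructible.induct)
  case (basic P q)
  have "f -` {x. (\<forall>p\<in>P. p x = 0) \<and> q x \<noteq> 0}
      = {x. (\<forall>p\<in>(\<lambda>p x. p (f x)) ` P. p x = 0) \<and> q (f x) \<noteq> 0}" by auto
  moreover have "constructible \<dots>"
    using basic by (intro constructible.basic) (auto intro: polynomial_fun_compose f)
  ultimately show ?case by simp
next
  case (Un S T)
  then show ?case by (simp add: constructible.Un)
qed

section \<open>Elimination of one variable\<close>

text \<open>
  A univariate polynomial whose coefficients depend polynomially on a parameter. The number \<open>n\<close>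
  bounds the formal length, one more than the degree, uniformly in the parameter; the actual
  degree may drop where leading coefficients vanish. The formal length is what decreases in the
  elimination below.
\<close>

definition poly_family :: "nat \<Rightarrow> (complex ^ 'i::finite \<Rightarrow> complex poly) \<Rightarrow> bool" where
  "poly_family n F \<longleftrightarrow>
    (\<forall>i. polynomial_fun (\<lambda>x. coeff (F x) i)) \<and> (\<forall>x. \<forall>i\<ge>n. coeff (F x) i = 0)"

lemma poly_family_mono: "poly_family m F \<Longrightarrow> m \<le> n \<Longrightarrow> poly_family n F"
  by (auto simp: poly_family_def)

lemma poly_family_0: "poly_family 0 F \<Longrightarrow> F x = 0"
  by (simp add: poly_family_def poly_eq_iff)

lemma poly_family_add:
  assumes "poly_family m F" "poly_family n G"
  shows "poly_family (max m n) (\<lambda>x. F x + G x)"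
  using assms by (auto simp: poly_family_def intro: polynomial_fun.add)

lemma poly_family_mult:
  assumes "poly_family m F" "poly_family n G"
  shows "poly_family (m + n) (\<lambda>x. F x * G x)"
  unfolding poly_family_def
proof (intro conjI allI impI)
  show "polynomial_fun (\<lambda>x. coeff (F x * G x) i)" for i
    unfolding coeff_mult
    using assms by (intro polynomial_fun_sum polynomial_fun.mult) (auto simp: poly_family_def)
next
  fix x i assume "m + n \<le> i"
  have "coeff (F x) j * coeff (G x) (i - j) = 0" if "j \<le> i" for j
  proof (cases "m \<le> j")
    case False
    then have "n \<le> i - j" using \<open>m + n \<le> i\<close> by simp
    then show ?thesis using assms(2) by (simp add: poly_family_def)
  qed (use assms(1) in \<open>simp add: poly_family_def\<close>)
  then show "coeff (F x * G x) i = 0"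
    unfolding coeff_mult by (intro sum.neutral) auto
qed

lemma poly_family_power:
  assumes "poly_family m F"
  shows "\<exists>n. poly_family n (\<lambda>x. F x ^ k)"
proof (induction k)
  case 0
  have "poly_family 1 (\<lambda>x. 1)"
    by (auto simp: poly_family_def coeff_1 intro: polynomial_fun.const)
  then show ?case by auto
next
  case (Suc k)
  then show ?case using poly_family_mult[OF assms] by auto
qed

lemma poly_family_drop_top:
  assumes "poly_family (Suc d) P"
  shows "poly_family d (\<lambda>x. P x - monom (coeff (P x) d) d)"
  unfolding poly_family_def
proof (intro conjI allI impI)
  show "polynomial_fun (\<lambda>x. coeff (P x - monom (coeff (P x) d) d) i)" for i
    using assms by (cases "i = d") (auto simp: poly_family_def intro: polynomial_fun.const)
  show "coeff (P x - monom (coeff (P x) d) d) i = 0" if "d \<le> i" for x i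
    using assms that by (cases "i = d") (auto simp: poly_family_def)
qed

text \<open>
  Division with remainder by \<open>P\<close>, made free of denominators by multiplying with a power of the
  leading coefficient, so that the remainder again depends polynomially on the parameter. The
  identity holds at every parameter, but it is informative only where that coefficient does not
  vanish.
\<close>

lemma poly_family_pseudo_remainder:
  assumes P: "poly_family (Suc d) P" and "poly_family n F"
  shows "\<exists>R e. poly_family d R \<and> (\<forall>x. \<exists>h. smult (coeff (P x) d ^ e) (F x) = h * P x + R x)"
  using assms(2)
proof (induction n arbitrary: F)
  case 0
  then have "poly_family d F" by (rule poly_family_mono) simp
  then show ?case
    by (intro exI[of _ F] exI[of _ 0]) (auto intro: exI[of _ 0])
next
  case (Suc n)
  show ?case
  proof (cases "Suc n \<le> d")
    case True
    with Suc.prems have "poly_family d F" by (rule poly_family_mono)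
    then show ?thesis
      by (intro exI[of _ F] exI[of _ 0]) (auto intro: exI[of _ 0])
  next
    case False
    define a where "a x = coeff (P x) d" for x
    define G where "G x = smult (a x) (F x) - monom (coeff (F x) n) (n - d) * P x" for x
    have coeff_G: "coeff (G x) i = a x * coeff (F x) i
        - (if i < n - d then 0 else coeff (F x) n * coeff (P x) (i - (n - d)))" for x i
      by (auto simp: G_def coeff_monom_mult not_le not_less)
    have "poly_family n G"
      unfolding poly_family_def
    proof (intro conjI allI impI)
      show "polynomial_fun (\<lambda>x. coeff (G x) i)" for i
        unfolding coeff_G a_def using P Suc.prems
        by (cases "i < n - d")
          (auto simp: poly_family_def intro!: polynomial_fun_diff polynomial_fun.intros)
      show "coeff (G x) i = 0" if "n \<le> i" for x i
      proof (cases "i = n")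
        case True
        then show ?thesis using False by (simp add: coeff_G a_def)
      next
        case neq: False
        then have "Suc d \<le> i - (n - d)" "Suc n \<le> i" using that False by auto
        then show ?thesis
          using P Suc.prems by (simp add: coeff_G poly_family_def)
      qed
    qed
    from Suc.IH[OF this] obtain R e where R: "poly_family d R"
      and e: "\<And>x. \<exists>h. smult (coeff (P x) d ^ e) (G x) = h * P x + R x" by blast
    have "\<exists>h. smult (coeff (P x) d ^ Suc e) (F x) = h * P x + R x" for x
    proof -
      from e[of x] obtain h where h: "smult (a x ^ e) (G x) = h * P x + R x"
        unfolding a_def by blast
      have "smult (a x ^ Suc e) (F x)
          = smult (a x ^ e) (G x) + smult (a x ^ e) (monom (coeff (F x) n) (n - d)) * P x"
        by (simp add: G_def smult_diff_right mult.commute)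
      also have "\<dots> = (h + smult (a x ^ e) (monom (coeff (F x) n) (n - d))) * P x + R x"
        by (simp add: h algebra_simps)
      finally show ?thesis unfolding a_def by blast
    qed
    with R show ?thesis by blast
  qed
qed

text \<open>
  Over \<open>\<complex>\<close> a polynomial \<open>P\<close> of degree \<open>d\<close> has all its roots among those of \<open>Q\<close> exactly when \<open>P\<close>
  divides \<open>Q\<^sup>d\<close>. Divisibility means that the pseudo-remainder vanishes, which is a condition on
  finitely many polynomial functions of the parameter.
\<close>

lemma constructible_root_outside:
  assumes P: "poly_family (Suc d) P" and Q: "poly_family m Q"
  shows "constructible {x. coeff (P x) d \<noteq> 0 \<and> (\<exists>t. poly (P x) t = 0 \<and> poly (Q x) t \<noteq> 0)}"
proof -
  obtain n where "poly_family n (\<lambda>x. Q x ^ d)"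
    using poly_family_power[OF Q] by blast
  from poly_family_pseudo_remainder[OF P this] obtain R e where R: "poly_family d R"
    and e: "\<And>x. \<exists>h. smult (coeff (P x) d ^ e) (Q x ^ d) = h * P x + R x" by blast
  have "(\<exists>t. poly (P x) t = 0 \<and> poly (Q x) t \<noteq> 0) \<longleftrightarrow> (\<exists>i<d. coeff (R x) i \<noteq> 0)"
    if a: "coeff (P x) d \<noteq> 0" for x
  proof -
    have deg: "degree (P x) = d"
      using P a by (intro antisym degree_le le_degree) (auto simp: poly_family_def)
    have "P x \<noteq> 0" using a by auto
    obtain h where h: "smult (coeff (P x) d ^ e) (Q x ^ d) = h * P x + R x" using e by blast
    have R_bound: "coeff (R x) i = 0" if "d \<le> i" for i
      using R that by (simp add: poly_family_def)
    have "(\<exists>t. poly (P x) t = 0 \<and> poly (Q x) t \<noteq> 0) \<longleftrightarrow> \<not> P x dvd Q x ^ d"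
      using nullstellensatz_univariate[of "P x" "Q x"] deg \<open>P x \<noteq> 0\<close> by auto
    also have "\<dots> \<longleftrightarrow> \<not> P x dvd smult (coeff (P x) d ^ e) (Q x ^ d)"
      using a by (simp add: dvd_smult_iff)
    also have "\<dots> \<longleftrightarrow> \<not> P x dvd R x"
      unfolding h by (simp add: dvd_add_right_iff)
    also have "\<dots> \<longleftrightarrow> R x \<noteq> 0"
    proof
      assume "R x \<noteq> 0"
      then have "degree (R x) < d"
        using R_bound by (metis leading_coeff_0_iff not_le)
      with \<open>R x \<noteq> 0\<close> show "\<not> P x dvd R x"
        using deg by (metis dvd_imp_degree_le not_le)
    qed auto
    also have "\<dots> \<longleftrightarrow> (\<exists>i<d. coeff (R x) i \<noteq> 0)"
      using R_bound by (metis coeff_0 not_le poly_eqI)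
    finally show ?thesis .
  qed
  then have "{x. coeff (P x) d \<noteq> 0 \<and> (\<exists>t. poly (P x) t = 0 \<and> poly (Q x) t \<noteq> 0)}
    = {x. coeff (P x) d \<noteq> 0} \<inter> {x. \<exists>i<d. coeff (R x) i \<noteq> 0}" by auto
  moreover have "constructible \<dots>"
    using P R by (intro constructible_Int constructible_nonzero constructible_some_nonzero)
      (auto simp: poly_family_def)
  ultimately show ?thesis by simp
qed

text \<open>
  This is the Euclidean algorithm with case distinctions, by induction on the total formal length
  of the equations. Where the leading coefficient of the shorter of two equations vanishes, that
  equation can be shortened; elsewhere the longer one can be replaced by its pseudo-remainder. At
  most one equation remains at the end, together with the inequation.
\<close>

lemma constructible_eliminate:
  fixes ps :: "((complex ^ 'i::finite \<Rightarrow> complex poly) \<times> nat) list"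
  assumes "\<forall>(P, n)\<in>set ps. poly_family n P" and Q: "poly_family m Q"
  shows "constructible {x. \<exists>t. (\<forall>(P, n)\<in>set ps. poly (P x) t = 0) \<and> poly (Q x) t \<noteq> 0}"
  using assms(1)
proof (induction "\<Sum>(P, n)\<leftarrow>ps. Suc n" arbitrary: ps rule: less_induct)
  case less
  define E where "E qs = {x. \<exists>t. (\<forall>(P, n)\<in>set qs. poly (P x) t = 0) \<and> poly (Q x) t \<noteq> 0}"
    for qs :: "((complex ^ 'i \<Rightarrow> complex poly) \<times> nat) list"
  have IH: "constructible (E qs)"
    if "(\<Sum>(P, n)\<leftarrow>qs. Suc n) < (\<Sum>(P, n)\<leftarrow>ps. Suc n)" "\<forall>(P, n)\<in>set qs. poly_family n P" for qs
    unfolding E_def using less.hyps that by blast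
  have two: "constructible (E ((P, n) # (F, k) # rest))"
    if meas: "(\<Sum>(P, n)\<leftarrow>(P, n) # (F, k) # rest. Suc n) = (\<Sum>(P, n)\<leftarrow>ps. Suc n)"
      and le: "n \<le> k" and P: "poly_family n P" and F: "poly_family k F"
      and rest: "\<forall>(P, n)\<in>set rest. poly_family n P" for P n F k rest
  proof (cases n)
    case 0
    with P have "E ((P, n) # (F, k) # rest) = E ((F, k) # rest)"
      by (auto simp: E_def poly_family_0)
    moreover have "constructible (E ((F, k) # rest))"
      using meas F rest by (intro IH) auto
    ultimately show ?thesis by simp
  next
    case (Suc d)
    define P' where "P' x = P x - monom (coeff (P x) d) d" for x
    have P': "poly_family d P'"
      using P poly_family_drop_top unfolding P'_def Suc by blast
    \<comment> \<open>On the zeros of \<open>P\<close> where its leading coefficient does not vanish, the equation \<open>F\<close>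
      may be exchanged for the shorter \<open>R\<close>.\<close>
    from poly_family_pseudo_remainder[OF P[unfolded Suc] F] obtain R e where R: "poly_family d R"
      and e: "\<And>x. \<exists>h. smult (coeff (P x) d ^ e) (F x) = h * P x + R x" by blast
    have reduce: "poly (F x) t = 0 \<longleftrightarrow> poly (R x) t = 0"
      if a: "coeff (P x) d \<noteq> 0" and t: "poly (P x) t = 0" for x t
    proof -
      obtain h where "smult (coeff (P x) d ^ e) (F x) = h * P x + R x" using e by blast
      then have "poly (smult (coeff (P x) d ^ e) (F x)) t = poly (h * P x + R x) t" by simp
      with a t show ?thesis by auto
    qed
    have "E ((P, n) # (F, k) # rest) =
        {x. coeff (P x) d = 0} \<inter> E ((P', d) # (F, k) # rest) \<union>
        {x. coeff (P x) d \<noteq> 0} \<inter> E ((P, n) # (R, d) # rest)"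
    proof (intro set_eqI)
      fix x
      show "x \<in> E ((P, n) # (F, k) # rest) \<longleftrightarrow> x \<in> {x. coeff (P x) d = 0} \<inter> E ((P', d) # (F, k) # rest) \<union>
        {x. coeff (P x) d \<noteq> 0} \<inter> E ((P, n) # (R, d) # rest)"
      proof (cases "coeff (P x) d = 0")
        case True
        then show ?thesis by (simp add: E_def P'_def)
      next
        case False
        then show ?thesis using reduce[OF False] by (auto simp: E_def)
      qed
    qed
    moreover have "constructible \<dots>"
    proof (intro constructible.Un constructible_Int)
      show "constructible {x. coeff (P x) d = 0}" "constructible {x. coeff (P x) d \<noteq> 0}"
        using P by (auto simp: poly_family_def intro: constructible_zero constructible_nonzero)
      show "constructible (E ((P', d) # (F, k) # rest))"
        using meas P' F rest Suc by (intro IH) auto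
      show "constructible (E ((P, n) # (R, d) # rest))"
        using meas le P R rest Suc by (intro IH) auto
    qed
    ultimately show ?thesis by simp
  qed
  have "constructible (E ps)"
  proof (cases ps)
    case Nil
    \<comment> \<open>A nonzero complex polynomial has a non-root, because the field is infinite.\<close>
    have "(\<exists>t. poly (Q x) t \<noteq> 0) \<longleftrightarrow> (\<exists>i<m. coeff (Q x) i \<noteq> 0)" for x
      using Q unfolding poly_family_def
      by (metis coeff_0 not_le poly_0 poly_all_0_iff_0 poly_eqI)
    then have "E ps = {x. \<exists>i<m. coeff (Q x) i \<noteq> 0}"
      by (simp add: E_def Nil)
    then show ?thesis
      using Q by (simp add: poly_family_def constructible_some_nonzero)
  next
    case (Cons Pn qs)
    obtain P n where Pn: "Pn = (P, n)" by (cases Pn)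
    have P: "poly_family n P" using less.prems by (simp add: Cons Pn)
    show ?thesis
    proof (cases qs)
      case Nil
      show ?thesis
      proof (cases n)
        case 0
        with P have "E ps = E []" by (auto simp: E_def Cons Pn Nil poly_family_0)
        moreover have "constructible (E [])" by (rule IH) (auto simp: Cons Pn)
        ultimately show ?thesis by simp
      next
        case (Suc d)
        define P' where "P' x = P x - monom (coeff (P x) d) d" for x
        have P': "poly_family d P'"
          using P poly_family_drop_top unfolding P'_def Suc by blast
        have "E ps = {x. coeff (P x) d = 0} \<inter> E [(P', d)] \<union>
            {x. coeff (P x) d \<noteq> 0 \<and> (\<exists>t. poly (P x) t = 0 \<and> poly (Q x) t \<noteq> 0)}"
        proof (intro set_eqI)
          fix x
          show "x \<in> E ps \<longleftrightarrow> x \<in> {x. coeff (P x) d = 0} \<inter> E [(P', d)] \<union>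
            {x. coeff (P x) d \<noteq> 0 \<and> (\<exists>t. poly (P x) t = 0 \<and> poly (Q x) t \<noteq> 0)}"
            by (cases "coeff (P x) d = 0") (simp_all add: E_def P'_def Cons Pn Nil)
        qed
        moreover have "constructible \<dots>"
        proof (intro constructible.Un constructible_Int)
          show "constructible {x. coeff (P x) d = 0}"
            using P by (auto simp: poly_family_def intro: constructible_zero)
          show "constructible (E [(P', d)])"
            using P' Suc by (intro IH) (auto simp: Cons Pn Nil)
          show "constructible {x. coeff (P x) d \<noteq> 0 \<and> (\<exists>t. poly (P x) t = 0 \<and> poly (Q x) t \<noteq> 0)}"
            using constructible_root_outside P Q unfolding Suc .
        qed
        ultimately show ?thesis by simp
      qed
    next
      case Cons': (Cons Fk rest)
      obtain F k where Fk: "Fk = (F, k)" by (cases Fk)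
      have F: "poly_family k F" and rest: "\<forall>(P, n)\<in>set rest. poly_family n P"
        using less.prems by (auto simp: Cons Cons' Pn Fk)
      show ?thesis
      proof (cases "n \<le> k")
        case True
        show ?thesis
          unfolding Cons Cons' Pn Fk using True P F rest
          by (intro two) (auto simp: Cons Cons' Pn Fk)
      next
        case False
        have "E ps = E ((F, k) # (P, n) # rest)"
          by (auto simp: E_def Cons Cons' Pn Fk)
        moreover have "constructible (E ((F, k) # (P, n) # rest))"
          using False P F rest by (intro two) (auto simp: Cons Cons' Pn Fk)
        ultimately show ?thesis by simp
      qed
    qed
  qed
  then show ?case by (simp add: E_def)
qed

section \<open>Projections of constructible sets\<close>

definition vec_upd :: "complex ^ 'i::finite \<Rightarrow> 'i \<Rightarrow> complex \<Rightarrow> complex ^ 'i" where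
  "vec_upd x i t = (\<chi> j. if j = i then t else x $ j)"

lemma polynomial_fun_as_family:
  assumes "polynomial_fun p"
  shows "\<exists>n F. poly_family n F \<and> (\<forall>x t. poly (F x) t = p (vec_upd x i t))"
  using assms
proof (induction rule: polynomial_fun.induct)
  case (const c)
  have "poly_family 1 (\<lambda>x. [:c:])"
    by (auto simp: poly_family_def coeff_pCons split: nat.split intro: polynomial_fun.const)
  then show ?case by (intro exI conjI) auto
next
  case (coord j)
  show ?case
  proof (cases "j = i")
    case True
    have "poly_family 2 (\<lambda>x. [:0, 1:])"
      by (auto simp: poly_family_def coeff_pCons split: nat.split intro: polynomial_fun.const)
    then show ?thesis by (intro exI conjI) (auto simp: vec_upd_def True)
  next
    case False
    have "polynomial_fun (\<lambda>x. coeff [:x $ j:] k)" for k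
      by (cases k) (auto intro: polynomial_fun.intros)
    then have "poly_family 1 (\<lambda>x. [:x $ j:])"
      by (auto simp: poly_family_def coeff_pCons split: nat.split)
    then show ?thesis by (intro exI conjI) (auto simp: vec_upd_def False)
  qed
next
  case (add p q)
  then obtain m F n G where "poly_family m F" "\<forall>x t. poly (F x) t = p (vec_upd x i t)"
    "poly_family n G" "\<forall>x t. poly (G x) t = q (vec_upd x i t)" by blast
  then show ?case
    by (intro exI[of _ "max m n"] exI[of _ "\<lambda>x. F x + G x"]) (simp add: poly_family_add)
next
  case (mult p q)
  then obtain m F n G where "poly_family m F" "\<forall>x t. poly (F x) t = p (vec_upd x i t)"
    "poly_family n G" "\<forall>x t. poly (G x) t = q (vec_upd x i t)" by blast
  then show ?case
    by (intro exI[of _ "m + n"] exI[of _ "\<lambda>x. F x * G x"]) (simp add: poly_family_mult)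
qed

lemma constructible_forget_coordinate:
  assumes "constructible S"
  shows "constructible {x. \<exists>t. vec_upd x i t \<in> S}"
  using assms
proof (induction rule: constructible.induct)
  case (basic P q)
  have "\<forall>p\<in>P. \<exists>n F. poly_family n F \<and> (\<forall>x t. poly (F x) t = p (vec_upd x i t))"
    using basic polynomial_fun_as_family by blast
  then obtain n F where F: "\<And>p. p \<in> P \<Longrightarrow> poly_family (n p) (F p)"
    "\<And>p x t. p \<in> P \<Longrightarrow> poly (F p x) t = p (vec_upd x i t)" by metis
  obtain m Q where Q: "poly_family m Q" "\<And>x t. poly (Q x) t = q (vec_upd x i t)"
    using basic polynomial_fun_as_family by metis
  obtain l where l: "set l = P" using \<open>finite P\<close> finite_list by blast
  have "constructible {x. \<exists>t. (\<forall>(G, k)\<in>set (map (\<lambda>p. (F p, n p)) l). poly (G x) t = 0)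
      \<and> poly (Q x) t \<noteq> 0}"
    using F Q l by (intro constructible_eliminate) auto
  also have "{x. \<exists>t. (\<forall>(G, k)\<in>set (map (\<lambda>p. (F p, n p)) l). poly (G x) t = 0) \<and> poly (Q x) t \<noteq> 0}
      = {x. \<exists>t. vec_upd x i t \<in> {x. (\<forall>p\<in>P. p x = 0) \<and> q x \<noteq> 0}}"
    using F Q l by auto
  finally show ?case .
next
  case (Un S T)
  have "{x. \<exists>t. vec_upd x i t \<in> S \<union> T}
      = {x. \<exists>t. vec_upd x i t \<in> S} \<union> {x. \<exists>t. vec_upd x i t \<in> T}" by auto
  with Un show ?case by (simp add: constructible.Un)
qed

lemma constructible_forget_coordinates:
  fixes S :: "(complex ^ 'i::finite) set"
  assumes "constructible S"
  shows "constructible {x. \<exists>z\<in>S. \<forall>v. v \<notin> W \<longrightarrow> z $ v = x $ v}"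
proof -
  have "finite W" by simp
  then show ?thesis
  proof (induction W rule: finite_induct)
    case empty
    have "{x. \<exists>z\<in>S. \<forall>v. v \<notin> {} \<longrightarrow> z $ v = x $ v} = S"
      by (auto simp: vec_eq_iff[symmetric])
    with assms show ?case by simp
  next
    case (insert w W)
    have "(\<exists>z\<in>S. \<forall>v. v \<notin> insert w W \<longrightarrow> z $ v = x $ v)
        \<longleftrightarrow> (\<exists>t. \<exists>z\<in>S. \<forall>v. v \<notin> W \<longrightarrow> z $ v = vec_upd x w t $ v)" for x
    proof
      assume "\<exists>z\<in>S. \<forall>v. v \<notin> insert w W \<longrightarrow> z $ v = x $ v"
      then obtain z where "z \<in> S" "\<forall>v. v \<notin> insert w W \<longrightarrow> z $ v = x $ v" by blast
      then show "\<exists>t. \<exists>z\<in>S. \<forall>v. v \<notin> W \<longrightarrow> z $ v = vec_upd x w t $ v"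
        by (intro exI[of _ "z $ w"] bexI[of _ z]) (auto simp: vec_upd_def)
    next
      assume "\<exists>t. \<exists>z\<in>S. \<forall>v. v \<notin> W \<longrightarrow> z $ v = vec_upd x w t $ v"
      then show "\<exists>z\<in>S. \<forall>v. v \<notin> insert w W \<longrightarrow> z $ v = x $ v"
        by (auto simp: vec_upd_def) metis
    qed
    with constructible_forget_coordinate[OF insert.IH, of w] show ?case by simp
  qed
qed

text \<open>
  The point \<open>(x, y)\<close> of \<open>\<complex>\<^sup>a \<times> \<complex>\<^sup>b\<close>, with the product encoded as \<open>\<complex>\<^sup>a\<^sup>+\<^sup>b\<close> so that polynomial functions
  on it are already available.
\<close>

definition vec_append :: "complex ^ 'a \<Rightarrow> complex ^ 'b \<Rightarrow> complex ^ ('a::finite + 'b::finite)" where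
  "vec_append x y = (\<chi> v. case v of Inl a \<Rightarrow> x $ a | Inr b \<Rightarrow> y $ b)"

text \<open>
  Chevalley's theorem for the projection \<open>\<complex>\<^sup>a \<times> \<complex>\<^sup>b \<rightarrow> \<complex>\<^sup>a\<close>: the coordinates of \<open>y\<close> are eliminated one
  after the other. The elimination itself takes place in the product; the section \<open>x \<mapsto> (x, 0)\<close>
  pulls its result back to \<open>\<complex>\<^sup>a\<close>.
\<close>

theorem constructible_projection:
  fixes S :: "(complex ^ ('a::finite + 'b::finite)) set"
  assumes "constructible S"
  shows "constructible {x. \<exists>y. vec_append x y \<in> S}"
proof -
  have "constructible ((\<lambda>x. vec_append x (0 :: complex ^ 'b)) -`
      {x. \<exists>z\<in>S. \<forall>v. v \<notin> range Inr \<longrightarrow> z $ v = x $ v})" (is "constructible ?T")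
  proof (intro constructible_preimage constructible_forget_coordinates assms)
    show "polynomial_fun (\<lambda>x. vec_append x (0 :: complex ^ 'b) $ v)" for v :: "'a + 'b"
      by (cases v) (auto simp: vec_append_def intro: polynomial_fun.intros)
  qed
  also have "?T = {x. \<exists>y. vec_append x y \<in> S}"
  proof (intro set_eqI iffI)
    fix x assume "x \<in> ?T"
    then obtain z where z: "z \<in> S" "\<And>v. v \<notin> range Inr \<Longrightarrow> z $ v = vec_append x (0 :: complex ^ 'b) $ v"
      by auto
    have "z $ Inl a = x $ a" for a
      using z(2)[of "Inl a"] by (auto simp: vec_append_def)
    then have eq: "vec_append x (\<chi> b. z $ Inr b) = z"
      by (auto simp: vec_append_def vec_eq_iff split: sum.split)
    then show "x \<in> {x. \<exists>y. vec_append x y \<in> S}"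
      using z(1) by (intro CollectI exI[of _ "\<chi> b. z $ Inr b"]) (simp only: eq)
  next
    fix x assume "x \<in> {x. \<exists>y. vec_append x y \<in> S}"
    then obtain y where y: "vec_append x y \<in> S" by blast
    have "vec_append x y $ v = vec_append x (0 :: complex ^ 'b) $ v" if "v \<notin> range Inr" for v
      using that by (cases v) (auto simp: vec_append_def)
    then show "x \<in> ?T" using y by auto
  qed
  finally show ?thesis .
qed

section \<open>Zariski closures and irreducibility\<close>

lemma zariski_closure_iff:
  assumes "S \<subseteq> V"
  shows "x \<in> zariski V closure_of S \<longleftrightarrow>
    x \<in> V \<and> (\<forall>p. polynomial_fun p \<longrightarrow> (\<forall>s\<in>S. p s = 0) \<longrightarrow> p x = 0)"
proof -
  let ?I = "{p. polynomial_fun p \<and> (\<forall>s\<in>S. p s = 0)}"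
  have "zariski V closure_of S = zero_locus V ?I"
  proof
    have "S \<subseteq> zero_locus V ?I"
      using assms unfolding zero_locus_def by blast
    moreover have "closedin (zariski V) (zero_locus V ?I)"
      unfolding closedin_zariski by (intro exI[of _ ?I] conjI refl) blast
    ultimately show "zariski V closure_of S \<subseteq> zero_locus V ?I"
      by (rule closure_of_minimal)
  next
    obtain P where P: "P \<subseteq> Collect polynomial_fun" "zariski V closure_of S = zero_locus V P"
      using closedin_closure_of[of "zariski V" S] unfolding closedin_zariski by blast
    have "S \<subseteq> zero_locus V P"
      using closure_of_subset[of S "zariski V"] assms P(2) by simp
    with P(1) have "P \<subseteq> ?I"
      unfolding zero_locus_def by blast
    then show "zero_locus V ?I \<subseteq> zariski V closure_of S"
      unfolding P(2) zero_locus_def by blast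
  qed
  then show ?thesis
    by (auto simp: zero_locus_def)
qed

lemma zariski_closure_subset_iff:
  assumes "S \<subseteq> V" "T \<subseteq> V"
  shows "zariski V closure_of S \<subseteq> zariski V closure_of T \<longleftrightarrow>
    (\<forall>p. polynomial_fun p \<longrightarrow> (\<forall>t\<in>T. p t = 0) \<longrightarrow> (\<forall>s\<in>S. p s = 0))"
proof
  assume sub: "zariski V closure_of S \<subseteq> zariski V closure_of T"
  have "S \<subseteq> zariski V closure_of S"
    using assms(1) by (simp add: closure_of_subset)
  with sub show "\<forall>p. polynomial_fun p \<longrightarrow> (\<forall>t\<in>T. p t = 0) \<longrightarrow> (\<forall>s\<in>S. p s = 0)"
    using zariski_closure_iff[OF assms(2)] by blast
next
  assume "\<forall>p. polynomial_fun p \<longrightarrow> (\<forall>t\<in>T. p t = 0) \<longrightarrow> (\<forall>s\<in>S. p s = 0)"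
  then show "zariski V closure_of S \<subseteq> zariski V closure_of T"
    using zariski_closure_iff[OF assms(1)] zariski_closure_iff[OF assms(2)] by auto
qed

text \<open>
  For nonempty \<open>V\<close> this says that the vanishing ideal of \<open>V\<close> is prime, equivalently that the
  Zariski closure of \<open>V\<close> is irreducible. It applies directly to the
  sets of sums of powers, which are not closed in general.
\<close>

definition irreducible_on :: "(complex ^ 'i::finite) set \<Rightarrow> bool" where
  "irreducible_on V \<longleftrightarrow> (\<forall>p q. polynomial_fun p \<longrightarrow> polynomial_fun q \<longrightarrow>
    (\<forall>x\<in>V. p x * q x = 0) \<longrightarrow> (\<forall>x\<in>V. p x = 0) \<or> (\<forall>x\<in>V. q x = 0))"

text \<open>
  If neither of two polynomial functions vanishes on \<open>V\<close>, join a nonzero of the one to a nonzero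
  of the other by a polynomial curve. Along the curve both become nonzero polynomials in one
  variable, so their product is nonzero somewhere on it.
\<close>

lemma irreducible_on_if_curves:
  assumes curves: "\<And>a b. a \<in> V \<Longrightarrow> b \<in> V \<Longrightarrow>
    \<exists>\<gamma> :: complex \<Rightarrow> complex ^ 'i::finite. \<gamma> 0 = a \<and> \<gamma> 1 = b \<and> range \<gamma> \<subseteq> V
      \<and> (\<forall>i. \<exists>c. \<forall>t. \<gamma> t $ i = poly c t)"
  shows "irreducible_on V"
  unfolding irreducible_on_def
proof (intro allI impI)
  fix p q assume p: "polynomial_fun p" and q: "polynomial_fun q" and pq: "\<forall>x\<in>V. p x * q x = 0"
  show "(\<forall>x\<in>V. p x = 0) \<or> (\<forall>x\<in>V. q x = 0)"
  proof (rule ccontr)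
    assume "\<not> ?thesis"
    then obtain a b where ab: "a \<in> V" "p a \<noteq> 0" "b \<in> V" "q b \<noteq> 0" by blast
    from curves[OF ab(1,3)] obtain \<gamma> where \<gamma>: "\<gamma> 0 = a" "\<gamma> 1 = b" "range \<gamma> \<subseteq> V"
      "\<And>i. \<exists>c. \<forall>t. \<gamma> t $ i = poly c t" by blast
    obtain c d where c: "\<And>t. p (\<gamma> t) = poly c t" and d: "\<And>t. q (\<gamma> t) = poly d t"
      using polynomial_fun_curve[OF p, of \<gamma>] polynomial_fun_curve[OF q, of \<gamma>] \<gamma>(4) by metis
    have "poly (c * d) t = 0" for t
      using pq \<gamma>(3) c[of t, symmetric] d[of t, symmetric] by (simp add: image_subset_iff)
    then have "c * d = 0"
      using poly_all_0_iff_0 by blast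
    then show False
      using ab(2,4) \<gamma>(1,2) c[of 0] d[of 1] by auto
  qed
qed

text \<open>
  On an irreducible set, membership in a constructible set is constant outside a proper
  hypersurface. In particular, a constructible dense subset contains a nonempty open one.
\<close>

lemma constructible_generically_decided:
  assumes "constructible S" and irr: "irreducible_on V" and "V \<noteq> {}"
  shows "\<exists>q. polynomial_fun q \<and> (\<exists>x\<in>V. q x \<noteq> 0) \<and>
    ({x\<in>V. q x \<noteq> 0} \<subseteq> S \<or> {x\<in>V. q x \<noteq> 0} \<inter> S = {})"
  using assms(1)
proof (induction rule: constructible.induct)
  case (basic P q)
  show ?case
  proof (cases "\<forall>p\<in>P. \<forall>x\<in>V. p x = 0")
    case P: True
    show ?thesis
    proof (cases "\<forall>x\<in>V. q x = 0")
      case True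
      with \<open>V \<noteq> {}\<close> show ?thesis
        by (intro exI[of _ "\<lambda>_. 1"]) (auto intro: polynomial_fun.const)
    next
      case False
      with P basic show ?thesis by (intro exI[of _ q]) auto
    qed
  next
    case False
    then obtain p where "p \<in> P" "\<exists>x\<in>V. p x \<noteq> 0" by blast
    with basic show ?thesis by (intro exI[of _ p]) auto
  qed
next
  case (Un S T)
  then obtain p q where p: "polynomial_fun p" "\<exists>x\<in>V. p x \<noteq> 0"
      "{x\<in>V. p x \<noteq> 0} \<subseteq> S \<or> {x\<in>V. p x \<noteq> 0} \<inter> S = {}"
    and q: "polynomial_fun q" "\<exists>x\<in>V. q x \<noteq> 0"
      "{x\<in>V. q x \<noteq> 0} \<subseteq> T \<or> {x\<in>V. q x \<noteq> 0} \<inter> T = {}" by blast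
  have "\<exists>x\<in>V. p x * q x \<noteq> 0"
    using irr p(1,2) q(1,2) unfolding irreducible_on_def by blast
  moreover have "{x\<in>V. p x * q x \<noteq> 0} \<subseteq> S \<union> T \<or> {x\<in>V. p x * q x \<noteq> 0} \<inter> (S \<union> T) = {}"
    using p(3) q(3) by auto
  ultimately show ?case
    using polynomial_fun.mult[OF p(1) q(1)] by blast
qed

section \<open>Sums of powers of vectors\<close>

definition power_sums :: "nat \<Rightarrow> ('k::finite, 'n::finite) tensor set" where
  "power_sums r = {A. \<exists>y. A = (\<Sum>i<r. tensor_power (y i))}"

lemma tensor_power_0: "tensor_power 0 = (0 :: ('k::finite, 'n::finite) tensor)"
  by (simp add: tensor_power_def vec_eq_iff)

lemma tensor_power_scale:
  "tensor_power (c *s y) = c ^ CARD('k) *s (tensor_power y :: ('k::finite, 'n::finite) tensor)"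
  by (simp add: tensor_power_def vec_eq_iff prod.distrib)

lemma power_sums_0: "power_sums 0 = {0}"
  by (simp add: power_sums_def)

lemma power_sums_Suc: "power_sums (Suc r) = {A. \<exists>y. A - tensor_power y \<in> power_sums r}"
proof (intro set_eqI iffI)
  fix A :: "('a, 'b) tensor" assume "A \<in> power_sums (Suc r)"
  then obtain y where "A = (\<Sum>i<Suc r. tensor_power (y i))"
    by (auto simp: power_sums_def)
  then have "A - tensor_power (y r) \<in> power_sums r"
    by (auto simp: power_sums_def)
  then show "A \<in> {A. \<exists>y. A - tensor_power y \<in> power_sums r}" by blast
next
  fix A :: "('a, 'b) tensor" assume "A \<in> {A. \<exists>y. A - tensor_power y \<in> power_sums r}"
  then obtain z y where "A - tensor_power z = (\<Sum>i<r. tensor_power (y i))"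
    by (auto simp: power_sums_def)
  then have "A = (\<Sum>i<Suc r. tensor_power ((y(r := z)) i))"
    by (simp add: algebra_simps)
  then show "A \<in> power_sums (Suc r)"
    unfolding power_sums_def by blast
qed

lemma power_sums_mono:
  assumes "r \<le> s"
  shows "power_sums r \<subseteq> power_sums s"
proof -
  have "power_sums m \<subseteq> power_sums (Suc m)" for m
    unfolding power_sums_Suc by (auto intro!: exI[of _ 0] simp: tensor_power_0)
  then show ?thesis
    by (rule lift_Suc_mono_le[OF _ assms])
qed

lemma finite_sum_in_power_sums:
  assumes "finite J"
  shows "(\<Sum>j\<in>J. tensor_power (y j)) \<in> power_sums (card J)"
  using assms
proof (induction J rule: finite_induct)
  case empty
  then show ?case by (simp add: power_sums_0)
next
  case (insert j J)
  then show ?case by (auto simp: power_sums_Suc intro!: exI[of _ "y j"])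
qed

lemma power_sums_symmetric: "power_sums r \<subseteq> sym_tensors"
proof
  fix A :: "('a, 'b) tensor" assume "A \<in> power_sums r"
  then obtain y where A: "A = (\<Sum>i<r. tensor_power (y i))"
    by (auto simp: power_sums_def)
  have "(\<Prod>j\<in>UNIV. v $ m (\<pi> j)) = (\<Prod>j\<in>UNIV. v $ m j)"
    if "bij \<pi>" for v :: "complex ^ 'b" and m and \<pi> :: "'a \<Rightarrow> 'a"
    using that by (rule prod.reindex_bij_betw)
  then show "A \<in> sym_tensors"
    by (simp add: sym_tensors_def A tensor_power_def)
qed

text \<open>
  Two sums of \<open>r\<close> powers are joined by moving every base vector along a complex line.
\<close>

lemma irreducible_power_sums: "irreducible_on (power_sums r :: ('k::finite, 'n::finite) tensor set)"
proof (rule irreducible_on_if_curves)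
  fix A B :: "('k, 'n) tensor"
  assume "A \<in> power_sums r" "B \<in> power_sums r"
  then obtain y z where A: "A = (\<Sum>i<r. tensor_power (y i))" and B: "B = (\<Sum>i<r. tensor_power (z i))"
    by (auto simp: power_sums_def)
  define \<gamma> :: "complex \<Rightarrow> ('k, 'n) tensor"
    where "\<gamma> t = (\<Sum>i<r. tensor_power (y i + t *s (z i - y i)))" for t
  have coord: "\<gamma> t $ m = poly (\<Sum>i<r. \<Prod>j\<in>UNIV. [:y i $ m j, z i $ m j - y i $ m j:]) t" for t m
    by (simp add: \<gamma>_def tensor_power_def poly_sum poly_prod algebra_simps)
  have "\<exists>c. \<forall>t. \<gamma> t $ m = poly c t" for m
    using coord by blast
  moreover have "\<gamma> 0 = A" "\<gamma> 1 = B" by (simp_all add: \<gamma>_def A B)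
  moreover have "range \<gamma> \<subseteq> power_sums r"
    by (auto simp: \<gamma>_def power_sums_def)
  ultimately show "\<exists>\<gamma>. \<gamma> 0 = A \<and> \<gamma> 1 = B \<and> range \<gamma> \<subseteq> power_sums r
      \<and> (\<forall>i. \<exists>c. \<forall>t. \<gamma> t $ i = poly c t)"
    by blast
qed

text \<open>
  Inductively, \<open>power_sums (Suc r)\<close> is the projection of the pairs \<open>(A, y)\<close> for which
  \<open>A - tensor_power y\<close> is a sum of \<open>r\<close> powers, and these pairs form a preimage of a constructible
  set under a polynomial map.
\<close>

lemma constructible_power_sums: "constructible (power_sums r :: ('k::finite, 'n::finite) tensor set)"
proof (induction r)
  case 0
  have "power_sums 0 =
      {x :: ('k, 'n) tensor. (\<forall>p\<in>range (\<lambda>m x. x $ m). p x = 0) \<and> (\<lambda>x. 1 :: complex) x \<noteq> 0}"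
    by (auto simp: power_sums_0 vec_eq_iff)
  moreover have "constructible \<dots>"
    by (intro constructible.basic) (auto intro: polynomial_fun.intros)
  ultimately show ?case by simp
next
  case (Suc r)
  define f :: "complex ^ (('k \<Rightarrow> 'n) + 'n) \<Rightarrow> ('k, 'n) tensor"
    where "f z = (\<chi> m. z $ Inl m - (\<Prod>j\<in>UNIV. z $ Inr (m j)))" for z
  have f: "f (vec_append x y) = x - tensor_power y" for x y
    by (simp add: f_def vec_append_def tensor_power_def vec_eq_iff)
  have "constructible (f -` power_sums r)"
    by (intro constructible_preimage Suc)
      (auto simp: f_def intro!: polynomial_fun_diff polynomial_fun_prod polynomial_fun.coord)
  then have "constructible {x. \<exists>y. vec_append x y \<in> f -` power_sums r}"
    by (rule constructible_projection)
  then show ?case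
    by (simp add: f power_sums_Suc)
qed

text \<open>
  Expanding each power over the maps \<open>f\<close> that assign to every tensor factor one of the vectors in
  the subset, the alternating sum over subsets keeps by inclusion and exclusion only the surjective
  \<open>f\<close>, which are the permutations. The result is the sum of all permutations of the tensor product of the
  vectors; coordinatewise it is Ryser's formula for the permanent.
\<close>

lemma polarization:
  fixes v :: "'k::finite \<Rightarrow> complex ^ 'n::finite"
  shows "(\<Sum>S\<in>UNIV. (-1) ^ card (- S) *s (tensor_power (\<Sum>j\<in>S. v j) :: ('k, 'n) tensor)) $ m
    = (\<Sum>\<pi> | bij \<pi>. \<Prod>l\<in>UNIV. v (\<pi> l) $ m l)"
proof -
  define c where "c f = (\<Prod>l\<in>UNIV. v (f l) $ m l)" for f :: "'k \<Rightarrow> 'k"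
  have expand: "(\<Prod>l\<in>UNIV. \<Sum>j\<in>S. v j $ m l) = (\<Sum>f\<in>UNIV. if range f \<subseteq> S then c f else 0)" for S
  proof -
    have "(\<Prod>l\<in>UNIV. \<Sum>j\<in>S. v j $ m l) = (\<Sum>f\<in>PiE UNIV (\<lambda>_. S). c f)"
      unfolding c_def by (rule prod_sum_PiE) auto
    also have "PiE UNIV (\<lambda>_. S) = {f. range f \<subseteq> S}"
      by (auto simp: PiE_UNIV_domain)
    finally show ?thesis
      by (simp add: sum.If_cases)
  qed
  have signs: "(\<Sum>S\<in>UNIV. if range f \<subseteq> S then (-1) ^ card (- S) else 0) = (if bij f then 1 else (0 :: complex))"
    for f :: "'k \<Rightarrow> 'k"
  proof -
    \<comment> \<open>The signed sum is the expansion of a product that has a factor \<open>1 - 1\<close> for each element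
      outside the range of \<open>f\<close>.\<close>
    let ?b = "\<lambda>j. if j \<in> range f then 0 else (-1 :: complex)"
    have "(\<Sum>S\<in>UNIV. if range f \<subseteq> S then (-1) ^ card (- S) else 0)
        = (\<Sum>S\<in>Pow UNIV. (\<Prod>j\<in>S. 1) * (\<Prod>j\<in>UNIV - S. ?b j))"
    proof (rule sum.cong)
      fix S :: "'k set"
      show "(if range f \<subseteq> S then (-1) ^ card (- S) else 0) = (\<Prod>j\<in>S. 1) * (\<Prod>j\<in>UNIV - S. ?b j)"
      proof (cases "range f \<subseteq> S")
        case True
        then have "(\<Prod>j\<in>UNIV - S. ?b j) = (\<Prod>j\<in>UNIV - S. -1)"
          by (intro prod.cong) auto
        with True show ?thesis by (simp add: Compl_eq_Diff_UNIV)
      next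
        case False
        then have "(\<Prod>j\<in>UNIV - S. ?b j) = 0"
          by (intro prod_zero) auto
        with False show ?thesis by simp
      qed
    qed simp
    also have "\<dots> = (\<Prod>j\<in>UNIV. 1 + ?b j)"
      by (rule prod_add[symmetric]) simp
    also have "\<dots> = (if surj f then 1 else 0)"
    proof (cases "surj f")
      case False
      then show ?thesis by (auto intro!: prod_zero)
    qed simp
    also have "surj f \<longleftrightarrow> bij f"
      using finite_UNIV_surj_inj[of f] by (auto simp: bij_def)
    finally show ?thesis .
  qed
  have "(\<Sum>S\<in>UNIV. (-1) ^ card (- S) *s (tensor_power (\<Sum>j\<in>S. v j) :: ('k, 'n) tensor)) $ m
      = (\<Sum>S\<in>UNIV. \<Sum>f\<in>UNIV. c f * (if range f \<subseteq> S then (-1) ^ card (- S) else 0))"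
    by (simp add: tensor_power_def expand sum_distrib_left if_distrib mult.commute cong: if_cong)
  also have "\<dots> = (\<Sum>f\<in>UNIV. c f * (\<Sum>S\<in>UNIV. if range f \<subseteq> S then (-1) ^ card (- S) else 0))"
    by (subst sum.swap) (simp add: sum_distrib_left)
  also have "\<dots> = (\<Sum>f | bij f. c f)"
    by (simp add: signs sum.If_cases if_distrib cong: if_cong)
  finally show ?thesis by (simp add: c_def)
qed

text \<open>
  A symmetric tensor is \<open>1 / k!\<close> times the sum of its permutations, so expanding it in the standard basis and
  polarizing each basis tensor writes it as a linear combination of powers. The coefficients are
  absorbed into the vectors by taking \<open>k\<close>-th roots in \<open>\<complex>\<close>. The number of terms does not depend on the
  tensor, so the symmetric rank is bounded.
\<close>

lemma sym_tensors_eq_power_sums: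
  "\<exists>R. sym_tensors = (power_sums R :: ('k::finite, 'n::finite) tensor set)"
proof -
  \<comment> \<open>\<open>N\<close> is \<open>k!\<close>, the number of permutations of the factors.\<close>
  define N :: complex where "N = of_nat (card {\<pi> :: 'k \<Rightarrow> 'k. bij \<pi>})"
  have "card {\<pi> :: 'k \<Rightarrow> 'k. bij \<pi>} \<noteq> 0"
    using bij_id by (auto simp: card_eq_0_iff)
  then have N: "N \<noteq> 0" by (simp add: N_def)
  have "A \<in> power_sums (card (UNIV :: (('k \<Rightarrow> 'n) \<times> 'k set) set))"
    if A: "A \<in> sym_tensors" for A :: "('k, 'n) tensor"
  proof -
    define w where "w i S = (\<Sum>j\<in>S. axis (i j) 1 :: complex ^ 'n)" for i and S :: "'k set"
    define a where "a i S = A $ i / N * (-1) ^ card (- S)" for i and S :: "'k set"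
    have "\<exists>c. a i S = c ^ CARD('k)" for i S
      using exists_complex_root[of "CARD('k)" "a i S"] by (metis zero_less_card_finite neq0_conv)
    then obtain c where c: "\<And>i S. c i S ^ CARD('k) = a i S" by metis
    have "A $ m = (\<Sum>(i, S)\<in>UNIV. tensor_power (c i S *s w i S)) $ m" for m
    proof -
      have "(\<Sum>(i, S)\<in>UNIV. tensor_power (c i S *s w i S)) $ m
          = (\<Sum>i\<in>UNIV. \<Sum>S\<in>UNIV. a i S * (tensor_power (w i S) :: ('k, 'n) tensor) $ m)"
        by (simp add: tensor_power_scale c sum.cartesian_product case_prod_unfold
            flip: UNIV_Times_UNIV)
      also have "\<dots> = (\<Sum>i\<in>UNIV. A $ i / N *
          (\<Sum>S\<in>UNIV. (-1) ^ card (- S) *s (tensor_power (w i S) :: ('k, 'n) tensor)) $ m)"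
        by (simp add: a_def sum_distrib_left mult.assoc)
      also have "\<dots> = (\<Sum>i\<in>UNIV. A $ i / N * (\<Sum>\<pi> | bij \<pi>. if i \<circ> \<pi> = m then 1 else 0))"
      proof -
        have "(\<Prod>l\<in>UNIV. axis (i (\<pi> l)) 1 $ m l) = (if i \<circ> \<pi> = m then 1 else 0 :: complex)"
          for i :: "'k \<Rightarrow> 'n" and \<pi> :: "'k \<Rightarrow> 'k"
        proof (cases "i \<circ> \<pi> = m")
          case True
          then show ?thesis by (auto simp: axis_def)
        next
          case False
          then obtain l where "i (\<pi> l) \<noteq> m l" by (auto simp: fun_eq_iff)
          then have "(\<Prod>l\<in>UNIV. axis (i (\<pi> l)) 1 $ m l) = (0 :: complex)"
            by (intro prod_zero bexI[of _ l]) (auto simp: axis_def)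
          with False show ?thesis by simp
        qed
        then show ?thesis by (simp only: w_def polarization)
      qed
      also have "\<dots> = (\<Sum>\<pi> | bij \<pi>. \<Sum>i\<in>UNIV. if i \<circ> \<pi> = m then A $ i / N else 0)"
        by (subst sum.swap) (simp add: sum_distrib_left if_distrib cong: if_cong)
      also have "\<dots> = (\<Sum>\<pi> | bij (\<pi> :: 'k \<Rightarrow> 'k). A $ m / N)"
      proof (rule sum.cong)
        fix \<pi> :: "'k \<Rightarrow> 'k" assume "\<pi> \<in> {\<pi>. bij \<pi>}"
        then have \<pi>: "bij \<pi>" by simp
        have "i \<circ> \<pi> = m \<longleftrightarrow> i = m \<circ> inv \<pi>" for i
          using \<pi> by (metis bij_is_inj bij_is_surj comp_assoc comp_id inj_iff surj_iff)
        then have "(\<Sum>i\<in>UNIV. if i \<circ> \<pi> = m then A $ i / N else 0) = A $ (m \<circ> inv \<pi>) / N"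
          by simp
        also have "A $ (m \<circ> inv \<pi>) = A $ m"
          using A bij_imp_bij_inv[OF \<pi>] unfolding sym_tensors_def by blast
        finally show "(\<Sum>i\<in>UNIV. if i \<circ> \<pi> = m then A $ i / N else 0) = A $ m / N" .
      qed simp
      also have "\<dots> = A $ m"
        using N by (simp add: N_def)
      finally show ?thesis by simp
    qed
    then have "A = (\<Sum>iS\<in>UNIV. tensor_power (c (fst iS) (snd iS) *s w (fst iS) (snd iS)))"
      by (simp add: vec_eq_iff case_prod_unfold)
    also have "\<dots> \<in> power_sums (card (UNIV :: (('k \<Rightarrow> 'n) \<times> 'k set) set))"
      by (rule finite_sum_in_power_sums) simp
    finally show ?thesis .
  qed
  then show ?thesis
    using power_sums_symmetric by (intro exI) blast
qed

section \<open>Closures of the sets of given symmetric rank\<close>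

text \<open>
  Since every symmetric tensor is a sum of powers, the least number that defines its rank is
  attained, and a shorter sum can be padded with powers of the zero vector.
\<close>

lemma sym_rank_le_eq_power_sums: "sym_rank_le r = power_sums r"
proof -
  have "sym_rank A \<le> r \<longleftrightarrow> A \<in> power_sums r" if A: "A \<in> sym_tensors" for A :: "('a, 'b) tensor"
  proof
    obtain R where "A \<in> power_sums R"
      using A sym_tensors_eq_power_sums by blast
    then have "A \<in> power_sums (sym_rank A)"
      unfolding power_sums_def sym_rank_def mem_Collect_eq by (rule LeastI)
    then show "A \<in> power_sums r" if "sym_rank A \<le> r"
      using power_sums_mono[OF that] by blast
    show "sym_rank A \<le> r" if "A \<in> power_sums r"
      using that unfolding power_sums_def sym_rank_def mem_Collect_eq by (rule Least_le)
  qed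
  then show ?thesis
    using power_sums_symmetric by (auto simp: sym_rank_le_def)
qed

lemma sym_rank_eq_eq_diff: "sym_rank_eq (Suc r) = power_sums (Suc r) - power_sums r"
proof -
  have "sym_rank_eq (Suc r) = sym_rank_le (Suc r) - sym_rank_le r"
    by (auto simp: sym_rank_eq_def sym_rank_le_def)
  then show ?thesis by (simp add: sym_rank_le_eq_power_sums)
qed

lemma closure_power_sums_generic:
  "zariski sym_tensors closure_of
    (power_sums (generic_sym_rank TYPE('k) TYPE('n)) :: ('k::finite, 'n::finite) tensor set) = sym_tensors"
proof -
  obtain R where "sym_tensors = (power_sums R :: ('k, 'n) tensor set)"
    using sym_tensors_eq_power_sums by blast
  then have "zariski sym_tensors closure_of (sym_rank_le R :: ('k, 'n) tensor set) = sym_tensors"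
    by (metis closure_of_topspace sym_rank_le_eq_power_sums topspace_zariski)
  then have "zariski sym_tensors closure_of
      (sym_rank_le (generic_sym_rank TYPE('k) TYPE('n)) :: ('k, 'n) tensor set) = sym_tensors"
    unfolding generic_sym_rank_def by (rule LeastI)
  then show ?thesis by (simp add: sym_rank_le_eq_power_sums)
qed

text \<open>
  Below the generic rank, adding one more power enlarges the Zariski closure. If it did not, every
  polynomial vanishing on the sums of \<open>r\<close> powers would also vanish on those of \<open>r + 1\<close> powers;
  since translation by a fixed power preserves polynomial functions, the same would follow for
  all longer sums. The closure would then be the whole space already at \<open>r\<close>.
\<close>

lemma power_sums_separated:
  assumes "r < generic_sym_rank TYPE('k) TYPE('n)"
  shows "\<exists>p. polynomial_fun p \<and> (\<forall>A\<in>power_sums r. p A = 0)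
    \<and> (\<exists>A\<in>(power_sums (Suc r) :: ('k::finite, 'n::finite) tensor set). p A \<noteq> 0)"
proof (rule ccontr)
  assume "\<not> ?thesis"
  then have step: "\<forall>A\<in>(power_sums (Suc r) :: ('k, 'n) tensor set). p A = 0"
    if "polynomial_fun p" "\<forall>A\<in>(power_sums r :: ('k, 'n) tensor set). p A = 0" for p
    using that by blast
  have all: "\<forall>A\<in>(power_sums s :: ('k, 'n) tensor set). p A = 0"
    if "polynomial_fun p" "\<forall>A\<in>(power_sums r :: ('k, 'n) tensor set). p A = 0" for p s
    using that
  proof (induction s arbitrary: p)
    case 0
    then show ?case using power_sums_mono[of 0 r] by blast
  next
    case (Suc s)
    show ?case
    proof
      fix A :: "('k, 'n) tensor" assume "A \<in> power_sums (Suc s)"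
      then obtain y where y: "A - tensor_power y \<in> power_sums s"
        unfolding power_sums_Suc by blast
      let ?p = "\<lambda>B. p (B + tensor_power y)"
      have "polynomial_fun ?p"
        using Suc.prems(1) by (rule polynomial_fun_compose) (auto intro: polynomial_fun.intros)
      moreover have "B + tensor_power y \<in> power_sums (Suc r)"
        if "B \<in> power_sums r" for B :: "('k, 'n) tensor"
        unfolding power_sums_Suc using that by (auto intro!: exI[of _ y])
      then have "\<forall>B\<in>power_sums r. ?p B = 0"
        using step Suc.prems by blast
      ultimately have "\<forall>B\<in>power_sums s. ?p B = 0"
        by (rule Suc.IH)
      then have "?p (A - tensor_power y) = 0"
        using y by blast
      then show "p A = 0" by simp
    qed
  qed
  obtain R where R: "sym_tensors = (power_sums R :: ('k, 'n) tensor set)"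
    using sym_tensors_eq_power_sums by blast
  have "zariski sym_tensors closure_of (sym_rank_le r :: ('k, 'n) tensor set) = sym_tensors"
    unfolding sym_rank_le_eq_power_sums
    using all[of _ R] zariski_closure_iff[OF power_sums_symmetric] R by blast
  then have "generic_sym_rank TYPE('k) TYPE('n) \<le> r"
    unfolding generic_sym_rank_def by (rule Least_le)
  with assms show False by simp
qed

text \<open>
  The tensors of rank exactly \<open>r\<close> contain the nonempty open part of the sums of \<open>r\<close> powers on which
  a polynomial separating them from the sums of \<open>r - 1\<close> powers does not vanish. By irreducibility
  this part is dense.
\<close>

lemma closure_sym_rank_eq:
  assumes "0 < r" "r \<le> generic_sym_rank TYPE('k) TYPE('n)"
  shows "zariski sym_tensors closure_of (sym_rank_eq r :: ('k::finite, 'n::finite) tensor set)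
    = zariski sym_tensors closure_of power_sums r"
proof -
  obtain s where s: "r = Suc s" using assms(1) gr0_implies_Suc by blast
  obtain q where q: "polynomial_fun q" "\<forall>A\<in>(power_sums s :: ('k, 'n) tensor set). q A = 0"
    "\<exists>A\<in>(power_sums r :: ('k, 'n) tensor set). q A \<noteq> 0"
    using power_sums_separated[where 'k = 'k and 'n = 'n, of s] assms(2) unfolding s by auto
  have sub: "(sym_rank_eq r :: ('k, 'n) tensor set) \<subseteq> sym_tensors"
    by (auto simp: sym_rank_eq_def)
  have "\<forall>A\<in>(power_sums r :: ('k, 'n) tensor set). p A = 0"
    if p: "polynomial_fun p" "\<forall>A\<in>(sym_rank_eq r :: ('k, 'n) tensor set). p A = 0" for p
  proof -
    have "\<forall>A\<in>(power_sums r :: ('k, 'n) tensor set). p A * q A = 0"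
      using p(2) q(2) unfolding s sym_rank_eq_eq_diff by auto
    then show ?thesis
      using irreducible_power_sums p(1) q(1,3) unfolding irreducible_on_def by blast
  qed
  then have "zariski sym_tensors closure_of power_sums r
      \<subseteq> zariski sym_tensors closure_of (sym_rank_eq r :: ('k, 'n) tensor set)"
    by (simp add: zariski_closure_subset_iff power_sums_symmetric sub)
  moreover have "(sym_rank_eq r :: ('k, 'n) tensor set) \<subseteq> power_sums r"
    unfolding s sym_rank_eq_eq_diff by blast
  ultimately show ?thesis
    by (simp add: closure_of_mono subset_antisym)
qed

lemma closure_power_sums_psubset:
  assumes "r < s" "s \<le> generic_sym_rank TYPE('k) TYPE('n)"
  shows "zariski sym_tensors closure_of (power_sums r :: ('k::finite, 'n::finite) tensor set)
    \<subset> zariski sym_tensors closure_of power_sums s"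
proof -
  have "\<exists>p. polynomial_fun p \<and> (\<forall>A\<in>power_sums r. p A = 0)
      \<and> (\<exists>A\<in>(power_sums (Suc r) :: ('k, 'n) tensor set). p A \<noteq> 0)"
    using assms by (intro power_sums_separated) simp
  moreover have "(power_sums (Suc r) :: ('k, 'n) tensor set) \<subseteq> power_sums s"
    using assms by (intro power_sums_mono) simp
  ultimately have "\<not> zariski sym_tensors closure_of power_sums s
      \<subseteq> zariski sym_tensors closure_of (power_sums r :: ('k, 'n) tensor set)"
    unfolding zariski_closure_subset_iff[OF power_sums_symmetric power_sums_symmetric] by blast
  moreover have "zariski sym_tensors closure_of (power_sums r :: ('k, 'n) tensor set)
      \<subseteq> zariski sym_tensors closure_of power_sums s"
    using assms by (intro closure_of_mono power_sums_mono) simp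
  ultimately show ?thesis by blast
qed

text \<open>
  Being constructible and dense, the sums of \<open>g\<close> powers for the generic rank \<open>g\<close> contain a nonempty
  open set. Tensors of larger rank lie in its complement, a proper closed subset. Density alone
  does not suffice here: two disjoint sets can both be dense.
\<close>

lemma closure_sym_rank_eq_above_generic:
  assumes "generic_sym_rank TYPE('k) TYPE('n) < r"
  shows "zariski sym_tensors closure_of (sym_rank_eq r :: ('k::finite, 'n::finite) tensor set) \<subset> sym_tensors"
proof -
  define g where "g = generic_sym_rank TYPE('k) TYPE('n)"
  obtain R where R: "sym_tensors = (power_sums R :: ('k, 'n) tensor set)"
    using sym_tensors_eq_power_sums by blast
  have irr: "irreducible_on (sym_tensors :: ('k, 'n) tensor set)"
    unfolding R by (rule irreducible_power_sums)
  have "(sym_tensors :: ('k, 'n) tensor set) \<noteq> {}"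
    unfolding R by (auto simp: power_sums_def)
  from constructible_generically_decided[OF constructible_power_sums irr this, of g]
  obtain q where q: "polynomial_fun q" "\<exists>A\<in>(sym_tensors :: ('k, 'n) tensor set). q A \<noteq> 0"
    "{A\<in>sym_tensors. q A \<noteq> 0} \<subseteq> (power_sums g :: ('k, 'n) tensor set)
      \<or> {A\<in>sym_tensors. q A \<noteq> 0} \<inter> (power_sums g :: ('k, 'n) tensor set) = {}" by blast
  have "{A\<in>sym_tensors. q A \<noteq> 0} \<subseteq> (power_sums g :: ('k, 'n) tensor set)"
  proof (rule ccontr)
    assume "\<not> ?thesis"
    then have "\<forall>A\<in>(power_sums g :: ('k, 'n) tensor set). q A = 0"
      using q(3) power_sums_symmetric by blast
    then show False
      using q(1,2) closure_power_sums_generic[where 'k = 'k and 'n = 'n]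
        zariski_closure_iff[OF power_sums_symmetric[where 'a = 'k and 'b = 'n and r = g]]
      unfolding g_def by blast
  qed
  moreover have "(sym_rank_eq r :: ('k, 'n) tensor set) \<inter> power_sums g = {}"
    using assms
    unfolding g_def[symmetric] sym_rank_le_eq_power_sums[symmetric]
    by (auto simp: sym_rank_eq_def sym_rank_le_def)
  moreover have sub: "(sym_rank_eq r :: ('k, 'n) tensor set) \<subseteq> sym_tensors"
    by (auto simp: sym_rank_eq_def)
  ultimately have "\<forall>A\<in>(sym_rank_eq r :: ('k, 'n) tensor set). q A = 0"
    by blast
  then have "\<not> sym_tensors \<subseteq> zariski sym_tensors closure_of (sym_rank_eq r :: ('k, 'n) tensor set)"
    using q(1,2) zariski_closure_iff[OF sub] by blast
  moreover have "zariski sym_tensors closure_of (sym_rank_eq r :: ('k, 'n) tensor set) \<subseteq> sym_tensors"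
    using zariski_closure_iff[OF sub] by blast
  ultimately show ?thesis by blast
qed

theorem proposition6p2:
  fixes r1 r2 r3 :: nat
  defines "Zc \<equiv> \<lambda>r. zariski sym_tensors closure_of (sym_rank_eq r :: ('k::finite, 'n::finite) tensor set)"
  assumes "0 < r1" "0 < r2" "0 < r3"
    and "r1 < r2"
    and "r2 < generic_sym_rank TYPE('k) TYPE('n)"
    and "generic_sym_rank TYPE('k) TYPE('n) < r3"
    and "r3 \<le> max_sym_rank TYPE('k) TYPE('n)"
  shows "Zc r1 \<subset> Zc r2
    \<and> Zc r2 \<subset> Zc (generic_sym_rank TYPE('k) TYPE('n))
    \<and> Zc (generic_sym_rank TYPE('k) TYPE('n)) \<supset> Zc r3"
proof -
  define g where "g = generic_sym_rank TYPE('k) TYPE('n)"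
  have Zc: "Zc r = zariski sym_tensors closure_of power_sums r" if "0 < r" "r \<le> g" for r
    using that unfolding Zc_def g_def by (rule closure_sym_rank_eq)
  have "Zc g = sym_tensors"
    using Zc[of g] assms(6) closure_power_sums_generic[where 'k = 'k and 'n = 'n]
    by (simp add: g_def)
  then have "Zc r3 \<subset> Zc g"
    using closure_sym_rank_eq_above_generic[OF assms(7)] by (simp add: Zc_def)
  moreover have "Zc r1 \<subset> Zc r2" "Zc r2 \<subset> Zc g"
    using assms(2-6) Zc[of r1] Zc[of r2] Zc[of g]
      closure_power_sums_psubset[where 'k = 'k and 'n = 'n, of r1 r2]
      closure_power_sums_psubset[where 'k = 'k and 'n = 'n, of r2 g]
    by (auto simp: g_def)
  ultimately show ?thesis by (simp add: g_def)
qed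

end
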